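(* Under the cyclic dynamic zone allocation strategy described in the context, applied to $n$ peers with zones of size $m$ and $n'=n/m$, the number of slots required for every peer to be grouped with every other peer (i.e. for every two peers to have been in a common zone in at least one slot) is $2n'-1$.
   Context: $m$ is even and divides $n$; $n'=n/m$. Partition the $n$ peers into $2n'$ sets $\nu_1,\dots,\nu_{2n'}$ of $m/2$ peers each. Dynamic zone allocation strategy: place $\nu_2,\dots,\nu_{2n'}$ (in this order) at the vertices of a regular $(2n'-1)$-gon and $\nu_1$ at its center. In successive slots, for $i=2,\dots,2n'$: let $L$ be the line through $\nu_1$ and $\nu_i$; let $M$ be the set of all pairs $(\nu_j,\nu_k)$ such that the line through $\nu_j,\nu_k$ is perpendicular to $L$, together with the pair $(\nu_1,\nu_i)$; the zones in this slot are the sets $\nu_j\cup\nu_k$ for $(\nu_j,\nu_k)\in M$. After $i=2n'$ the loop restarts at $i=2$. (For $n'=1$ the single zone is $\nu_1\cup\nu_2$.) In the perpendicularity condition, $j,k\in\{2,\dots,2n'\}\setminus\{i\}$. *)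

theory Defs
  imports "HOL-Analysis.Analysis" "HOL-Library.Extended_Nat"
begin

text \<open>The plane is \<^typ>\<open>complex\<close>. The points \<open>v 0, \<dots>, v (N - 1)\<close> are, in this order, the
  vertices of a regular \<open>N\<close>-gon with center \<open>c\<close>. Size, rotation and orientation
  (\<open>s = 1\<close> counterclockwise, \<open>s = -1\<close> clockwise) are arbitrary. For \<open>N = 1\<close>
  this is a single point different from \<open>c\<close>.\<close>

definition regular_polygon :: "nat \<Rightarrow> complex \<Rightarrow> (nat \<Rightarrow> complex) \<Rightarrow> bool" where
  "regular_polygon N c v \<longleftrightarrow>
     (\<exists>r \<theta> s. r > 0 \<and> s \<in> {1, -1} \<and>
        (\<forall>k<N. v k = c + rcis r (\<theta> + s * (2 * pi * real k / real N))))"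

definition perpendicular_lines :: "complex \<Rightarrow> complex \<Rightarrow> complex \<Rightarrow> complex \<Rightarrow> bool" where
  "perpendicular_lines p q p' q' \<longleftrightarrow> p \<noteq> q \<and> p' \<noteq> q' \<and> orthogonal (q - p) (q' - p')"

text \<open>In the following, \<open>n'\<close> is half the number of sets \<open>\<nu> 1, \<dots>, \<nu> (2 * n')\<close>, and
  \<open>pos j\<close> is the point at which \<open>\<nu> j\<close> is placed. Pairs of sets are represented by pairs
  of their indices.\<close>

definition zone_placement :: "nat \<Rightarrow> (nat \<Rightarrow> complex) \<Rightarrow> bool" where
  "zone_placement n' pos \<longleftrightarrow> regular_polygon (2 * n' - 1) (pos 1) (\<lambda>k. pos (k + 2))"

definition zone_pairs :: "nat \<Rightarrow> (nat \<Rightarrow> complex) \<Rightarrow> nat \<Rightarrow> (nat \<times> nat) set" where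
  "zone_pairs n' pos i =
     insert (1, i)
       {(j, k). j \<in> {2..2 * n'} - {i} \<and> k \<in> {2..2 * n'} - {i} \<and>
          perpendicular_lines (pos j) (pos k) (pos 1) (pos i)}"

text \<open>Slots are numbered from 0, so slot \<open>t\<close> has loop index \<open>2 + t mod (2 * n' - 1)\<close>.\<close>

definition slot_zones ::
    "nat \<Rightarrow> (nat \<Rightarrow> 'a set) \<Rightarrow> (nat \<Rightarrow> complex) \<Rightarrow> nat \<Rightarrow> 'a set set" where
  "slot_zones n' \<nu> pos t =
     (\<lambda>(j, k). \<nu> j \<union> \<nu> k) ` zone_pairs n' pos (2 + t mod (2 * n' - 1))"

text \<open>For a schedule \<open>Z\<close> (\<open>Z t\<close> is the set of zones in slot \<open>t\<close>): every two peers in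
  \<open>P\<close> have shared a zone during the first \<open>T\<close> slots.\<close>

definition all_grouped :: "'a set \<Rightarrow> (nat \<Rightarrow> 'a set set) \<Rightarrow> nat \<Rightarrow> bool" where
  "all_grouped P Z T \<longleftrightarrow>
     (\<forall>x\<in>P. \<forall>y\<in>P. x \<noteq> y \<longrightarrow> (\<exists>t<T. \<exists>z\<in>Z t. x \<in> z \<and> y \<in> z))"

text \<open>The least sufficient number of slots; it is \<open>\<infinity>\<close> if no number of slots suffices.\<close>

definition slots_required :: "'a set \<Rightarrow> (nat \<Rightarrow> 'a set set) \<Rightarrow> enat" where
  "slots_required P Z = (INF T\<in>{T. all_grouped P Z T}. enat T)"

end

theory Submission
  imports Defs
begin

text \<open>A peer of \<open>\<nu> 1\<close> shares a zone with one of \<open>\<nu> i\<close> only in the slots with loop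
  index \<open>i\<close>, so fewer than \<open>2 * n' - 1\<close> slots miss some pair. Conversely, reflecting the regular
  \<open>N\<close>-gon (\<open>N = 2 * n' - 1\<close>) in the axis through vertex \<open>i\<close> sends vertex \<open>p\<close> to the vertex \<open>q\<close>
  with \<open>p + q \<equiv> 2 * i\<close> modulo \<open>N\<close>, so the chord from \<open>p\<close> to \<open>q\<close> is perpendicular to that axis.
  As \<open>N\<close> is odd, every pair \<open>p \<noteq> q\<close> has such an \<open>i\<close>, namely \<open>(p + q) * n' mod N\<close>.\<close>

lemma regular_polygon_vertex_neq_center:
  assumes "regular_polygon N c v" "k < N"
  shows "v k \<noteq> c"
  using assms unfolding regular_polygon_def
  by (metis add_cancel_right_right less_irrefl rcis_eq_zero_iff)

lemma nat_eq_if_dvd_diff: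
  fixes p q N :: nat
  assumes "int N dvd int p - int q" "p < N" "q < N"
  shows "p = q"
proof -
  have "int p mod int N = int q mod int N"
    using assms(1) by (simp only: mod_eq_dvd_iff)
  then show ?thesis using assms(2,3) by simp
qed

text \<open>\<open>perpendicular_lines\<close> demands two distinct points on each line; injectivity
  secures this for the chords. Equal vertices have angles differing by a multiple of
  \<open>2 * pi\<close>, which makes \<open>N\<close> divide the difference of the indices.\<close>

lemma regular_polygon_inj_on:
  assumes "regular_polygon N c v"
  shows "inj_on v {..<N}"
proof (rule inj_onI)
  fix p q
  assume "p \<in> {..<N}" "q \<in> {..<N}" and eq: "v p = v q"
  then have pq: "p < N" "q < N" by auto
  then have N: "real N > 0" by auto
  from assms obtain r \<theta> s where r: "r > 0" and s: "s \<in> {1, -1 :: real}"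
    and v: "\<And>k. k < N \<Longrightarrow> v k = c + rcis r (\<theta> + s * (2 * pi * real k / real N))"
    unfolding regular_polygon_def by blast
  have "cis (\<theta> + s * (2 * pi * real p / real N)) = cis (\<theta> + s * (2 * pi * real q / real N))"
    using eq r by (simp add: v pq rcis_def)
  then obtain d :: int where
    "\<theta> + s * (2 * pi * real p / real N) = \<theta> + s * (2 * pi * real q / real N) + 2 * pi * d"
    by (auto simp: complex_eq_iff dest!: sin_cos_eq_iff[THEN iffD1, OF conjI])
  then have "2 * pi * (s * (real p - real q)) = 2 * pi * (d * real N)"
    using N by (simp add: field_simps)
  then have "s * (real p - real q) = d * real N" by simp
  \<comment> \<open>The two disjuncts are the orientations \<open>s = 1\<close> and
    \<open>s = -1\<close>; divisibility by \<open>N\<close> does not see the sign.\<close>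
  then have "real_of_int (int p - int q) = real_of_int (d * int N) \<or>
    real_of_int (int q - int p) = real_of_int (d * int N)"
    using s by auto
  then have "int p - int q = d * int N \<or> int q - int p = d * int N"
    by linarith
  then have "int N dvd int p - int q"
    by (metis dvd_minus_iff dvd_triv_right minus_diff_eq)
  then show "p = q"
    using nat_eq_if_dvd_diff pq by blast
qed

text \<open>Measured from vertex \<open>i\<close>, the angles of \<open>p\<close> and
  \<open>q\<close> are opposite modulo \<open>2 * pi\<close>, so their cosines agree; the inner
  product is \<open>r\<^sup>2\<close> times the difference of these cosines.\<close>

lemma regular_polygon_chord_orthogonal:
  assumes "regular_polygon N c v" "p < N" "q < N" "i < N"
    and sym: "int p + int q - 2 * int i = d * int N"
  shows "orthogonal (v i - c) (v q - v p)"
proof -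
  from assms(1) obtain r \<theta> s where s: "s \<in> {1, -1 :: real}"
    and v: "\<And>k. k < N \<Longrightarrow> v k = c + rcis r (\<theta> + s * (2 * pi * real k / real N))"
    unfolding regular_polygon_def by blast
  define a where "a k = \<theta> + s * (2 * pi * real k / real N)" for k
  have N: "real N > 0" using \<open>p < N\<close> by simp
  have "real_of_int (int p + int q - 2 * int i) = real_of_int (d * int N)"
    by (simp only: sym)
  then have q: "real q = 2 * real i - real p + d * real N" by simp
  have "a q - a i = - (a p - a i) + 2 * (s * d) * pi"
    using N unfolding a_def q by (simp add: field_simps)
  moreover have "s * d \<in> \<int>" using s by auto
  ultimately have "cos (a q - a i) = cos (a p - a i)"
    unfolding cos_eq by blast
  moreover have "inner (v i - c) (v q - v p) = r\<^sup>2 * (cos (a q - a i) - cos (a p - a i))"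
    unfolding v[OF \<open>p < N\<close>] v[OF \<open>q < N\<close>] v[OF \<open>i < N\<close>] a_def[symmetric]
    by (simp add: inner_complex_def cos_diff power2_eq_square algebra_simps)
  ultimately show ?thesis
    by (simp add: orthogonal_def)
qed

text \<open>Since \<open>2 * h = N + 1\<close>, \<open>h\<close> is the inverse of 2 modulo
  \<open>N\<close>, so \<open>(p + q) * h\<close> is a midpoint of \<open>p\<close> and
  \<open>q\<close> modulo \<open>N\<close>.\<close>

lemma odd_midpoint_mod:
  fixes p q h :: nat
  defines "N \<equiv> 2 * h - 1"
  assumes "h > 0" "p < N" "q < N" "p \<noteq> q"
  obtains i d where "i < N" "i \<noteq> p" "i \<noteq> q" "int p + int q - 2 * int i = d * int N"
proof -
  define i where "i = (p + q) * h mod N"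
  have N: "int N = 2 * int h - 1" using assms by simp
  have "int i = (int p + int q) * int h - ((int p + int q) * int h div int N) * int N"
    unfolding i_def by (simp add: zmod_int minus_div_mult_eq_mod)
  then have "int p + int q - 2 * int i =
      (2 * ((int p + int q) * int h div int N) - (int p + int q)) * int N"
    unfolding N by (simp add: algebra_simps)
  then obtain d where d: "int p + int q - 2 * int i = d * int N" by blast
  have eq: "p = q" if "int p - int q = e * int N" for e
    using nat_eq_if_dvd_diff[of N p q] that \<open>p < N\<close> \<open>q < N\<close> by simp
  \<comment> \<open>If \<open>i\<close> were \<open>p\<close> or \<open>q\<close>, the equation for
    \<open>d\<close> would make \<open>N\<close> divide \<open>p - q\<close>.\<close>
  have "i \<noteq> p" using d eq[of "- d"] \<open>p \<noteq> q\<close> by auto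
  moreover have "i \<noteq> q" using d eq[of d] \<open>p \<noteq> q\<close> by auto
  moreover have "i < N" using \<open>p < N\<close> by (simp add: i_def)
  ultimately show ?thesis using that d by blast
qed

lemma slot_zones_center:
  assumes "i \<in> {2..2 * n'}"
  shows "\<nu> 1 \<union> \<nu> i \<in> slot_zones n' \<nu> pos (i - 2)"
proof -
  \<comment> \<open>As \<open>i - 2 < 2 * n' - 1\<close>, slot \<open>i - 2\<close> lies in the
    first round of the loop and is the turn of \<open>i\<close>.\<close>
  have "2 + (i - 2) mod (2 * n' - 1) = i" using assms by auto
  then show ?thesis by (force simp: slot_zones_def zone_pairs_def)
qed

lemma slot_zones_chord:
  assumes "zone_placement n' pos" "j \<in> {2..2 * n'}" "k \<in> {2..2 * n'}" "j \<noteq> k"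
  shows "\<exists>t < 2 * n' - 1. \<nu> j \<union> \<nu> k \<in> slot_zones n' \<nu> pos t"
proof -
  let ?N = "2 * n' - 1" and ?v = "\<lambda>k. pos (k + 2)"
  define p q where "p = j - 2" and "q = k - 2"
  have pq: "j = p + 2" "k = q + 2" "p < ?N" "q < ?N" "p \<noteq> q" "n' > 0"
    using assms by (auto simp: p_def q_def)
  then obtain i d where i: "i < ?N" "i \<noteq> p" "i \<noteq> q" "int p + int q - 2 * int i = d * int ?N"
    using odd_midpoint_mod by metis
  have poly: "regular_polygon ?N (pos 1) ?v"
    using assms by (simp add: zone_placement_def)
  have "?v p \<noteq> ?v q"
    using inj_onD[OF regular_polygon_inj_on[OF poly]] pq by blast
  moreover have "pos 1 \<noteq> ?v i"
    using regular_polygon_vertex_neq_center[OF poly i(1)] by simp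
  moreover have "orthogonal (?v q - ?v p) (?v i - pos 1)"
    using regular_polygon_chord_orthogonal[OF poly pq(3,4) i(1,4)] by (simp add: orthogonal_commute)
  \<comment> \<open>Vertex \<open>i\<close> carries loop index \<open>i + 2\<close>; since
    \<open>i\<close> differs from \<open>p\<close> and \<open>q\<close>, neither \<open>j\<close>
    nor \<open>k\<close> is the index that \<open>zone_pairs\<close> excludes.\<close>
  ultimately have "(j, k) \<in> zone_pairs n' pos (2 + i mod ?N)"
    using assms i pq by (simp add: zone_pairs_def perpendicular_lines_def add.commute)
  then show ?thesis
    using i(1) by (force simp: slot_zones_def)
qed

lemma all_grouped_slot_zones:
  assumes "n' > 0" "zone_placement n' pos"
  shows "all_grouped (\<Union>i\<in>{1..2 * n'}. \<nu> i) (slot_zones n' \<nu> pos) (2 * n' - 1)"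
proof -
  have center: "\<exists>t < 2 * n' - 1. \<nu> 1 \<union> \<nu> i \<in> slot_zones n' \<nu> pos t" if "i \<in> {2..2 * n'}" for i
    using slot_zones_center[OF that, of \<nu> pos] that by (intro exI[of _ "i - 2"]) auto
  have zone: "\<exists>t < 2 * n' - 1. \<exists>z \<in> slot_zones n' \<nu> pos t. \<nu> j \<subseteq> z \<and> \<nu> k \<subseteq> z"
    if "j \<in> {1..2 * n'}" "k \<in> {1..2 * n'}" for j k
  proof -
    consider "j = 1" "k = 1" | "j = 1" "k \<in> {2..2 * n'}" | "k = 1" "j \<in> {2..2 * n'}"
      | "j = k" "j \<in> {2..2 * n'}" | "j \<noteq> k" "j \<in> {2..2 * n'}" "k \<in> {2..2 * n'}"
      using \<open>j \<in> {1..2 * n'}\<close> \<open>k \<in> {1..2 * n'}\<close> by force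
    then show ?thesis
    proof cases
      \<comment> \<open>Peers of one set are grouped by any zone containing that set; for
        \<open>\<nu> 1\<close> the zone \<open>\<nu> 1 \<union> \<nu> 2\<close> serves.\<close>
      case 1
      have "2 \<in> {2..2 * n'}" using assms by simp
      from center[OF this] 1 show ?thesis by blast
    next
      case 2
      from center[OF 2(2)] 2(1) show ?thesis by blast
    next
      case 3
      from center[OF 3(2)] 3(1) show ?thesis by blast
    next
      case 4
      from center[OF 4(2)] 4(1) show ?thesis by blast
    next
      case 5
      from slot_zones_chord[OF assms(2) 5(2,3,1), of \<nu>] show ?thesis by blast
    qed
  qed
  show ?thesis
    unfolding all_grouped_def
  proof (intro ballI impI)
    fix x y
    assume "x \<in> (\<Union>i\<in>{1..2 * n'}. \<nu> i)" "y \<in> (\<Union>i\<in>{1..2 * n'}. \<nu> i)"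
    then obtain j k where "j \<in> {1..2 * n'}" "x \<in> \<nu> j" "k \<in> {1..2 * n'}" "y \<in> \<nu> k"
      by blast
    then show "\<exists>t < 2 * n' - 1. \<exists>z \<in> slot_zones n' \<nu> pos t. x \<in> z \<and> y \<in> z"
      using zone[of j k] by blast
  qed
qed

lemma not_all_grouped_slot_zones:
  assumes disj: "disjoint_family_on \<nu> {1..2 * n'}"
    and ne: "\<And>i. i \<in> {1..2 * n'} \<Longrightarrow> \<nu> i \<noteq> {}"
    and T: "T < 2 * n' - 1"
  shows "\<not> all_grouped (\<Union>i\<in>{1..2 * n'}. \<nu> i) (slot_zones n' \<nu> pos) T"
proof
  assume all: "all_grouped (\<Union>i\<in>{1..2 * n'}. \<nu> i) (slot_zones n' \<nu> pos) T"
  \<comment> \<open>\<open>T + 2\<close> is the loop index of slot \<open>T\<close>, the first slot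
    after those counted, so \<open>\<nu> (T + 2)\<close> has not yet met
    \<open>\<nu> 1\<close>.\<close>
  have idx: "1 \<in> {1..2 * n'}" "T + 2 \<in> {1..2 * n'}" using T by auto
  then obtain x y where x: "x \<in> \<nu> 1" and y: "y \<in> \<nu> (T + 2)"
    using ne by blast
  have uniq: "i = j" if "z \<in> \<nu> i" "z \<in> \<nu> j" "i \<in> {1..2 * n'}" "j \<in> {1..2 * n'}" for z i j
    using disj that unfolding disjoint_family_on_def by blast
  have "x \<noteq> y" using uniq[OF _ _ idx] x y by auto
  then obtain t z where t: "t < T" and z: "z \<in> slot_zones n' \<nu> pos t" "x \<in> z" "y \<in> z"
    using all idx x y unfolding all_grouped_def by blast
  have "t mod (2 * n' - 1) = t" using t T by simp
  with z obtain j k where jk: "(j, k) \<in> zone_pairs n' pos (2 + t)" "z = \<nu> j \<union> \<nu> k"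
    unfolding slot_zones_def by force
  have range: "j \<in> {1..2 * n'}" "k \<in> {1..2 * n'}"
    using jk(1) t T by (auto simp: zone_pairs_def)
  then have "j = 1 \<or> k = 1"
    using uniq[OF x _ idx(1)] z(2) jk(2) by blast
  \<comment> \<open>Index 1 occurs only in the inserted pair, since all other pairs have entries at
    least 2.\<close>
  then have "j = 1" "k = t + 2"
    using jk(1) by (auto simp: zone_pairs_def)
  moreover have "j = T + 2 \<or> k = T + 2"
    using uniq[OF y _ idx(2)] range z(3) jk(2) by blast
  ultimately show False using t by simp
qed

theorem lemma7:
  fixes P :: "'a set" and m n n' :: nat
    and \<nu> :: "nat \<Rightarrow> 'a set" and pos :: "nat \<Rightarrow> complex"
  assumes "even m" and "m > 0" and "n > 0" and "m dvd n" and "n' = n div m"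
    and "finite P" and "card P = n"
    and "disjoint_family_on \<nu> {1..2 * n'}"
    and "(\<Union>i\<in>{1..2 * n'}. \<nu> i) = P"
    and "\<forall>i\<in>{1..2 * n'}. card (\<nu> i) = m div 2"
    and "zone_placement n' pos"
  shows "slots_required P (slot_zones n' \<nu> pos) = enat (2 * n' - 1)"
proof -
  have n': "n' > 0"
    using assms by (simp add: dvd_imp_le div_greater_zero_iff)
  \<comment> \<open>The lower bound picks a peer from each of two sets, so these must be nonempty;
    an even positive \<open>m\<close> is at least 2.\<close>
  have "m div 2 \<noteq> 0" using \<open>even m\<close> \<open>m > 0\<close> by auto
  then have ne: "\<nu> i \<noteq> {}" if "i \<in> {1..2 * n'}" for i
    using assms(10) that by (metis card.empty)
  have "all_grouped P (slot_zones n' \<nu> pos) (2 * n' - 1)"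
    using all_grouped_slot_zones[OF n' assms(11)] assms(9) by metis
  moreover have "2 * n' - 1 \<le> T" if "all_grouped P (slot_zones n' \<nu> pos) T" for T
    using not_all_grouped_slot_zones[OF assms(8) ne] that assms(9) by (metis not_le)
  ultimately show ?thesis
    unfolding slots_required_def by (intro antisym INF_lower INF_greatest) auto
qed

end
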